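(* Let $r \geq 2$, let $1 \leq k \leq r-1$, and let $H$ be a $k$-plateaued $r$-graph on at least $r+1$ vertices. Then $\mathfrak{F}(H)$ is not a $k$-tight family.
   Context: An $r$-graph $G$ is a finite simple $r$-uniform hypergraph with vertex set $V(G)$ and edge set $E(G) \subseteq \binom{V(G)}{r}$. It is connected if $V(G)$ cannot be partitioned into two nonempty sets such that every edge is contained in one of them. $\mathfrak{F}(H)$ is the family of all $r$-graphs that contain no copy of $H$ as a (not necessarily induced) subgraph. A partition $\lambda \vdash r$ is a tuple $\lambda = (\lambda_1,\dots,\lambda_\ell)$ of positive integers with $\lambda_1 \geq \cdots \geq \lambda_\ell$ and $\lambda_1 + \cdots + \lambda_\ell = r$; it is nontrivial if $\lambda \neq (r)$. Let $H$ be a connected $r$-graph and $\lambda \vdash r$ nontrivial with $\ell$ parts. An edge $e$ of $H$ is a $\lambda$-plateau if the $r$-graph $H - e$ (delete the edge $e$, keep all vertices) is a vertex-disjoint union $H - e = \bigsqcup_{j=1}^{\ell} H_j$ of $r$-graphs (not required to be connected), so that $V(H) = \bigsqcup_j V(H_j)$ and every edge of $H - e$ lies in some $V(H_j)$, with $|e \cap V(H_j)| = \lambda_j$ for $1 \leq j \leq \ell$. A (connected) $r$-graph $H$ is $k$-plateaued if for every $\lambda \vdash r$ with $k \leq \lambda_1 \leq r-1$, $H$ contains a $\lambda$-plateau. An $r$-graph $G$ is $k$-tight if $E(G) \neq \emptyset$ and, for every $U \subsetneq V(G)$ such that $U$ contains an edge of $G$, there is an edge $e \in E(G)$ such that $k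 \leq |e \cap U| \leq r-1$. For a family $\mathcal{F}$ of $r$-graphs, $G \in \mathcal{F}$ is edge-maximal (in $\mathcal{F}$) if there is no $G' \in \mathcal{F}$ with $V(G') = V(G)$ and $E(G) \subsetneq E(G')$. The family $\mathcal{F}$ is a $k$-tight family if every edge-maximal $G \in \mathcal{F}$ with $|V(G)| \geq r$ is $k$-tight. *)

theory Defs
  imports "HOL-Library.Infinite_Typeclass"
begin

datatype 'a hypergraph = Hypergraph (verts: "'a set") (edges: "'a set set")

definition r_graph :: "nat \<Rightarrow> 'a hypergraph \<Rightarrow> bool" where
  "r_graph r G \<longleftrightarrow> finite (verts G) \<and> (\<forall>e\<in>edges G. e \<subseteq> verts G \<and> card e = r)"

definition connected_hypergraph :: "'a hypergraph \<Rightarrow> bool" where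
  "connected_hypergraph G \<longleftrightarrow>
     \<not> (\<exists>A B. A \<noteq> {} \<and> B \<noteq> {} \<and> A \<inter> B = {} \<and> A \<union> B = verts G \<and>
          (\<forall>e\<in>edges G. e \<subseteq> A \<or> e \<subseteq> B))"

definition contains_copy :: "'a hypergraph \<Rightarrow> 'b hypergraph \<Rightarrow> bool" where
  "contains_copy H G \<longleftrightarrow>
     (\<exists>f. inj_on f (verts H) \<and> f ` verts H \<subseteq> verts G \<and> (\<forall>e\<in>edges H. f ` e \<in> edges G))"

(* The vertices of the members of the family come from the type 'b, which need not be
   the vertex type of H.  When 'b is infinite, every finite r-graph has an isomorphic
   copy over 'b. *)
definition free_family :: "nat \<Rightarrow> 'a hypergraph \<Rightarrow> 'b hypergraph set" where
  "free_family r H = {G. r_graph r G \<and> \<not> contains_copy H G}"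

definition partition_of :: "nat \<Rightarrow> nat list \<Rightarrow> bool" where
  "partition_of r p \<longleftrightarrow> (\<forall>i\<in>set p. 0 < i) \<and> sorted_wrt (\<ge>) p \<and> sum_list p = r"

definition delete_edge :: "'a hypergraph \<Rightarrow> 'a set \<Rightarrow> 'a hypergraph" where
  "delete_edge G e = Hypergraph (verts G) (edges G - {e})"

definition disjoint_union_of :: "'a hypergraph \<Rightarrow> 'a hypergraph list \<Rightarrow> bool" where
  "disjoint_union_of G Hs \<longleftrightarrow>
     (\<forall>i<length Hs. \<forall>j<length Hs. i \<noteq> j \<longrightarrow> verts (Hs ! i) \<inter> verts (Hs ! j) = {}) \<and>
     verts G = (\<Union>j<length Hs. verts (Hs ! j)) \<and>
     edges G = (\<Union>j<length Hs. edges (Hs ! j))"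

definition plateau :: "nat \<Rightarrow> 'a hypergraph \<Rightarrow> nat list \<Rightarrow> 'a set \<Rightarrow> bool" where
  "plateau r H p e \<longleftrightarrow>
     partition_of r p \<and> p \<noteq> [r] \<and> e \<in> edges H \<and>
     (\<exists>Hs. length Hs = length p \<and> (\<forall>j<length p. r_graph r (Hs ! j)) \<and>
           disjoint_union_of (delete_edge H e) Hs \<and>
           (\<forall>j<length p. card (e \<inter> verts (Hs ! j)) = p ! j))"

definition plateaued :: "nat \<Rightarrow> nat \<Rightarrow> 'a hypergraph \<Rightarrow> bool" where
  "plateaued r k H \<longleftrightarrow>
     r_graph r H \<and> connected_hypergraph H \<and>
     (\<forall>p. partition_of r p \<and> k \<le> hd p \<and> hd p \<le> r - 1 \<longrightarrow> (\<exists>e. plateau r H p e))"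

definition tight :: "nat \<Rightarrow> nat \<Rightarrow> 'a hypergraph \<Rightarrow> bool" where
  "tight r k G \<longleftrightarrow>
     edges G \<noteq> {} \<and>
     (\<forall>U. U \<subset> verts G \<and> (\<exists>e\<in>edges G. e \<subseteq> U) \<longrightarrow>
        (\<exists>e\<in>edges G. k \<le> card (e \<inter> U) \<and> card (e \<inter> U) \<le> r - 1))"

definition edge_maximal :: "'a hypergraph set \<Rightarrow> 'a hypergraph \<Rightarrow> bool" where
  "edge_maximal F G \<longleftrightarrow>
     G \<in> F \<and> \<not> (\<exists>G'\<in>F. verts G' = verts G \<and> edges G \<subset> edges G')"

definition tight_family :: "nat \<Rightarrow> nat \<Rightarrow> 'a hypergraph set \<Rightarrow> bool" where
  "tight_family r k F \<longleftrightarrow>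
     (\<forall>G. edge_maximal F G \<and> r \<le> card (verts G) \<longrightarrow> tight r k G)"

end

theory Submission
  imports Defs
begin

text \<open>
  Let \<open>n\<close> be the number of vertices of \<open>H\<close>. Two vertex-disjoint complete \<open>r\<close>-graphs \<open>A\<close> and \<open>B\<close>
  on \<open>n - 1\<close> vertices each contain no copy of \<open>H\<close>, because \<open>H\<close> is connected and too large for
  either clique (\<open>two_cliques_in_free_family\<close>). The plateaus of \<open>H\<close> forbid the new edges that would
  make this example tight: if a set \<open>e\<close> meets \<open>A\<close> in \<open>a\<close> vertices and \<open>B\<close> in \<open>b\<close> vertices, with
  \<open>a, b > 0\<close>, \<open>a + b = r\<close> and \<open>k \<le> a\<close>, then \<open>H\<close> has a plateau whose partition consists of \<open>a\<close> and
  \<open>b\<close>. Both pieces left by that plateau have at most \<open>n - 1\<close> vertices, so they fit into the cliques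
  in such a way that the plateau is mapped onto \<open>e\<close>; adding \<open>e\<close> therefore creates a copy of \<open>H\<close>
  (\<open>plateau_copy_across_cliques\<close>).

  An edge-maximal \<open>H\<close>-free \<open>r\<close>-graph that extends the two cliques is then not \<open>k\<close>-tight, with
  \<open>U = A\<close> as witness. The set \<open>A\<close> contains an edge because \<open>n - 1 \<ge> r\<close>.
\<close>

definition two_cliques :: "nat \<Rightarrow> 'b set \<Rightarrow> 'b set \<Rightarrow> 'b hypergraph" where
  "two_cliques r A B = Hypergraph (A \<union> B) {e. card e = r \<and> (e \<subseteq> A \<or> e \<subseteq> B)}"

lemma two_cliques_in_free_family:
  assumes H: "r_graph r H" "connected_hypergraph H"
    and fin: "finite A" "finite B" and disj: "A \<inter> B = {}"
    and small: "card A < card (verts H)" "card B < card (verts H)"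
  shows "two_cliques r A B \<in> free_family r H"
proof -
  have "\<not> contains_copy H (two_cliques r A B)"
  proof
    assume "contains_copy H (two_cliques r A B)"
    then obtain f where inj: "inj_on f (verts H)" and f: "f ` verts H \<subseteq> A \<union> B"
      and fe: "\<forall>e\<in>edges H. f ` e \<subseteq> A \<or> f ` e \<subseteq> B"
      by (auto simp: contains_copy_def two_cliques_def)
    define X where "X = {x \<in> verts H. f x \<in> A}"
    define Y where "Y = {x \<in> verts H. f x \<in> B}"
    have "X \<inter> Y = {}" using disj by (auto simp: X_def Y_def)
    moreover have "X \<union> Y = verts H" using f by (auto simp: X_def Y_def)
    moreover have "\<forall>e\<in>edges H. e \<subseteq> X \<or> e \<subseteq> Y"
    proof
      fix e assume e: "e \<in> edges H"
      then have "e \<subseteq> verts H" using H(1) by (auto simp: r_graph_def)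
      then show "e \<subseteq> X \<or> e \<subseteq> Y" using fe e unfolding X_def Y_def by blast
    qed
    ultimately have "X = {} \<or> Y = {}"
      using H(2) unfolding connected_hypergraph_def by blast
    then have "f ` verts H \<subseteq> A \<or> f ` verts H \<subseteq> B"
      using f unfolding X_def Y_def by blast
    then have "card (verts H) \<le> card A \<or> card (verts H) \<le> card B"
      using card_inj_on_le[OF inj] fin by blast
    then show False using small by linarith
  qed
  moreover have "r_graph r (two_cliques r A B)"
    using fin by (auto simp: r_graph_def two_cliques_def)
  ultimately show ?thesis by (simp add: free_family_def)
qed

lemma edge_maximal_extension:
  assumes G: "G \<in> free_family r H"
  obtains M where "edge_maximal (free_family r H) M"
    and "verts M = verts G" and "edges G \<subseteq> edges M"
proof -
  define S where "S = {E. Hypergraph (verts G) E \<in> free_family r H}"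
  have "finite (verts G)" using G by (simp add: free_family_def r_graph_def)
  moreover have "S \<subseteq> Pow (Pow (verts G))"
    by (auto simp: S_def free_family_def r_graph_def)
  ultimately have "finite S" by (meson finite_Pow_iff finite_subset)
  moreover have "edges G \<in> S" using G by (simp add: S_def)
  ultimately obtain E where E: "E \<in> S" "edges G \<subseteq> E" "\<forall>E'\<in>S. E \<subseteq> E' \<longrightarrow> E = E'"
    using finite_has_maximal2[of S "edges G"] by blast
  have "edge_maximal (free_family r H) (Hypergraph (verts G) E)"
    unfolding edge_maximal_def
  proof (intro conjI notI)
    show "Hypergraph (verts G) E \<in> free_family r H" using E(1) by (simp add: S_def)
    assume "\<exists>G'\<in>free_family r H. verts G' = verts (Hypergraph (verts G) E) \<and>
      edges (Hypergraph (verts G) E) \<subset> edges G'"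
    then obtain G' where G': "G' \<in> free_family r H" "verts G' = verts G" "E \<subset> edges G'"
      by auto
    then have "edges G' \<in> S" by (metis (mono_tags) S_def hypergraph.collapse mem_Collect_eq)
    then show False using E(3) G'(3) by blast
  qed
  then show thesis using that E(2) by simp
qed

lemma injection_with_prescribed_image:
  assumes "finite V" "S \<subseteq> V" "finite A" "T \<subseteq> A" "card S = card T" "card V \<le> card A"
  obtains f where "inj_on f V" and "f ` V \<subseteq> A" and "f ` S = T"
proof -
  have fin: "finite S" "finite T" using assms finite_subset by blast+
  obtain g where g: "bij_betw g S T"
    using finite_same_card_bij[OF fin assms(5)] by blast
  have "card (V - S) \<le> card (A - T)"
    using assms fin by (simp add: card_Diff_subset)
  then obtain h where h: "h ` (V - S) \<subseteq> A - T" "inj_on h (V - S)"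
    using card_le_inj[of "V - S" "A - T"] assms by auto
  define f where "f x = (if x \<in> S then g x else h x)" for x
  have fS: "f ` S = T" and injS: "inj_on f S"
    using g by (auto simp: f_def bij_betw_def inj_on_def)
  have fD: "f ` (V - S) \<subseteq> A - T" using h(1) by (auto simp: f_def)
  have injD: "inj_on f (V - S)" using h(2) by (auto simp: f_def inj_on_def)
  have V: "V = S \<union> (V - S)" using assms(2) by blast
  have "inj_on f (S \<union> (V - S))"
    unfolding inj_on_Un using injS injD fS fD by blast
  then have "inj_on f V" using V by simp
  moreover have "f ` V \<subseteq> A" using fS fD assms(4) V by blast
  ultimately show thesis using that fS by blast
qed

text \<open>
  The only edge of \<open>H\<close> that joins the two pieces of \<open>H - e\<^sub>0\<close> is the plateau \<open>e\<^sub>0\<close> itself. Hence any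
  injection of each piece into its own clique, chosen so that \<open>e\<^sub>0\<close> goes to \<open>e\<close>, is a copy of \<open>H\<close>.
  Positivity of \<open>a\<close> and \<open>b\<close> makes both pieces nonempty, so each piece has fewer vertices than \<open>H\<close>
  and fits into its clique.
\<close>
lemma plateau_copy_across_cliques:
  assumes H: "r_graph r H" and plat: "plateau r H [a, b] e\<^sub>0"
    and fin: "finite A" "finite B" and disj: "A \<inter> B = {}"
    and size: "card (verts H) \<le> Suc (card A)" "card (verts H) \<le> Suc (card B)"
    and vertsG: "A \<union> B \<subseteq> verts G"
    and cliques: "\<And>e. card e = r \<Longrightarrow> e \<subseteq> A \<or> e \<subseteq> B \<Longrightarrow> e \<in> edges G"
    and e: "e \<in> edges G" "e \<subseteq> A \<union> B" "card (e \<inter> A) = a" "card (e \<inter> B) = b"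
  shows "contains_copy H G"
proof -
  obtain Hs where Hs: "length Hs = length [a, b]"
      "\<forall>j<length [a, b]. r_graph r (Hs ! j)"
      "disjoint_union_of (delete_edge H e\<^sub>0) Hs"
      "\<forall>j<length [a, b]. card (e\<^sub>0 \<inter> verts (Hs ! j)) = [a, b] ! j"
    using plat unfolding plateau_def by blast
  obtain P Q where PQ: "Hs = [P, Q]"
    using Hs(1) by (auto simp: length_Suc_conv)
  have pos: "0 < a" "0 < b" using plat by (auto simp: plateau_def partition_of_def)
  have e\<^sub>0: "e\<^sub>0 \<in> edges H" using plat by (simp add: plateau_def)
  have graphs: "r_graph r P" "r_graph r Q" using Hs(2) PQ by (auto simp: less_Suc_eq)
  have card_e\<^sub>0: "card (e\<^sub>0 \<inter> verts P) = a" "card (e\<^sub>0 \<inter> verts Q) = b"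
    using Hs(4) PQ by (auto simp: less_Suc_eq)
  have two: "{..<Suc (Suc 0)} = {0, 1}" by auto
  have PQ_disj: "verts P \<inter> verts Q = {}"
    and PQ_verts: "verts H = verts P \<union> verts Q"
    and PQ_edges: "edges H - {e\<^sub>0} = edges P \<union> edges Q"
    using Hs(3) PQ by (auto simp: disjoint_union_of_def delete_edge_def two less_Suc_eq)
  have finPQ: "finite (verts P)" "finite (verts Q)"
    using graphs by (auto simp: r_graph_def)
  have "verts P \<noteq> {}" "verts Q \<noteq> {}" using card_e\<^sub>0 pos by auto
  then have "0 < card (verts P)" "0 < card (verts Q)" using finPQ by auto
  moreover have "card (verts H) = card (verts P) + card (verts Q)"
    using PQ_verts PQ_disj finPQ by (simp add: card_Un_disjoint)
  ultimately have fits: "card (verts P) \<le> card A" "card (verts Q) \<le> card B"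
    using size by linarith+
  obtain f where f: "inj_on f (verts P)" "f ` verts P \<subseteq> A" "f ` (e\<^sub>0 \<inter> verts P) = e \<inter> A"
    using injection_with_prescribed_image[of "verts P" "e\<^sub>0 \<inter> verts P" A "e \<inter> A"]
      finPQ fin fits e card_e\<^sub>0 by auto
  obtain g where g: "inj_on g (verts Q)" "g ` verts Q \<subseteq> B" "g ` (e\<^sub>0 \<inter> verts Q) = e \<inter> B"
    using injection_with_prescribed_image[of "verts Q" "e\<^sub>0 \<inter> verts Q" B "e \<inter> B"]
      finPQ fin fits e card_e\<^sub>0 by auto
  define h where "h x = (if x \<in> verts P then f x else g x)" for x
  have hP: "h ` S = f ` S" if "S \<subseteq> verts P" for S
    using that by (intro image_cong) (auto simp: h_def)
  have hQ: "h ` S = g ` S" if "S \<subseteq> verts Q" for S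
    using that PQ_disj by (intro image_cong) (auto simp: h_def)
  have "inj_on h (verts P)"
    using f(1) by (simp add: h_def inj_on_def)
  moreover have "inj_on h (verts Q)"
  proof -
    have "h x = g x" if "x \<in> verts Q" for x using that PQ_disj by (auto simp: h_def)
    then show ?thesis using g(1) inj_on_cong[of "verts Q" h g] by blast
  qed
  moreover have "h ` verts P \<subseteq> A" "h ` verts Q \<subseteq> B"
    using hP[of "verts P"] hQ[of "verts Q"] f(2) g(2) by simp_all
  ultimately have inj: "inj_on h (verts H)"
    unfolding PQ_verts inj_on_Un using disj by blast
  have img: "h ` verts P \<subseteq> A" "h ` verts Q \<subseteq> B" by fact+
  have "h ` e' \<in> edges G" if e': "e' \<in> edges H" for e'
  proof (cases "e' = e\<^sub>0")
    case True
    have "e\<^sub>0 = (e\<^sub>0 \<inter> verts P) \<union> (e\<^sub>0 \<inter> verts Q)"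
      using H e\<^sub>0 PQ_verts by (auto simp: r_graph_def)
    then have "h ` e\<^sub>0 = h ` (e\<^sub>0 \<inter> verts P) \<union> h ` (e\<^sub>0 \<inter> verts Q)"
      by (metis image_Un)
    also have "\<dots> = (e \<inter> A) \<union> (e \<inter> B)"
      using hP[of "e\<^sub>0 \<inter> verts P"] hQ[of "e\<^sub>0 \<inter> verts Q"] f(3) g(3) by simp
    also have "\<dots> = e" using e(2) by blast
    finally show ?thesis using True e(1) by simp
  next
    case False
    then have "e' \<in> edges P \<union> edges Q" using e' PQ_edges by blast
    then have "e' \<subseteq> verts P \<or> e' \<subseteq> verts Q" using graphs by (auto simp: r_graph_def)
    then have "h ` e' \<subseteq> A \<or> h ` e' \<subseteq> B" using img by blast
    moreover have "card (h ` e') = r"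
      using H e' inj by (metis card_image inj_on_subset r_graph_def)
    ultimately show ?thesis using cliques by blast
  qed
  moreover have "h ` verts H \<subseteq> verts G" using img PQ_verts vertsG by blast
  ultimately show ?thesis using inj unfolding contains_copy_def by blast
qed

theorem theorem7p1:
  fixes r k :: nat and H :: "'a hypergraph"
  assumes "2 \<le> r" and "1 \<le> k" and "k \<le> r - 1"
    and "plateaued r k H" and "r + 1 \<le> card (verts H)"
  shows "\<not> tight_family r k (free_family r H :: 'b::infinite hypergraph set)"
proof
  assume tight: "tight_family r k (free_family r H :: 'b hypergraph set)"
  have H: "r_graph r H" "connected_hypergraph H"
    and plateaus: "\<And>p. partition_of r p \<Longrightarrow> k \<le> hd p \<Longrightarrow> hd p \<le> r - 1 \<Longrightarrow> \<exists>e. plateau r H p e"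
    using assms(4) by (auto simp: plateaued_def)
  define m where "m = card (verts H) - 1"
  have m: "r \<le> m" "card (verts H) = Suc m" using assms(5) by (auto simp: m_def)
  obtain A :: "'b set" where A: "finite A" "card A = m"
    using infinite_arbitrarily_large[OF infinite_UNIV] by blast
  have "infinite (UNIV - A)" using A(1) infinite_UNIV by (rule Diff_infinite_finite)
  then obtain B :: "'b set" where B: "finite B" "card B = m" "B \<subseteq> UNIV - A"
    using infinite_arbitrarily_large by blast
  have disj: "A \<inter> B = {}" using B(3) by blast
  have "two_cliques r A B \<in> free_family r H"
    using two_cliques_in_free_family[OF H A(1) B(1) disj] A(2) B(2) m(2) by simp
  then obtain M where M: "edge_maximal (free_family r H) M"
      "verts M = A \<union> B" "edges (two_cliques r A B) \<subseteq> edges M"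
    by (rule edge_maximal_extension) (simp add: two_cliques_def)
  have M_graph: "r_graph r M" and M_free: "\<not> contains_copy H M"
    using M(1) by (auto simp: edge_maximal_def free_family_def)
  have cliques: "e \<in> edges M" if "card e = r" "e \<subseteq> A \<or> e \<subseteq> B" for e
    using that M(3) by (auto simp: two_cliques_def)
  have "card (A \<union> B) = m + m" using A B disj by (simp add: card_Un_disjoint)
  then have "tight r k M"
    using tight M(1,2) m(1) by (simp add: tight_family_def)
  moreover have "A \<subset> verts M"
  proof -
    have "B \<noteq> {}" using B(2) m(1) assms(1) by auto
    then show ?thesis using M(2) disj by blast
  qed
  moreover obtain e\<^sub>1 where "e\<^sub>1 \<subseteq> A" "card e\<^sub>1 = r"
    using obtain_subset_with_card_n[of r A] A(2) m(1) by blast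
  ultimately obtain e where e: "e \<in> edges M" "k \<le> card (e \<inter> A)" "card (e \<inter> A) \<le> r - 1"
    using cliques unfolding tight_def by blast
  define a where "a = card (e \<inter> A)"
  define b where "b = card (e \<inter> B)"
  have e_sub: "e \<subseteq> A \<union> B" and "card e = r"
    using M_graph M(2) e(1) by (auto simp: r_graph_def)
  moreover have "e = (e \<inter> A) \<union> (e \<inter> B)" using e_sub by blast
  moreover have "card ((e \<inter> A) \<union> (e \<inter> B)) = a + b"
    unfolding a_def b_def using A(1) B(1) disj by (intro card_Un_disjoint) auto
  ultimately have ab: "a + b = r" by simp
  have bounds: "k \<le> a" "a \<le> r - 1" "0 < a" "0 < b"
    using e ab assms(1,2) unfolding a_def[symmetric] by linarith+
  have "contains_copy H M"
  proof (cases "b \<le> a")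
    case True
    then have "partition_of r [a, b]" using ab bounds by (simp add: partition_of_def)
    then obtain e\<^sub>0 where "plateau r H [a, b] e\<^sub>0" using plateaus[of "[a, b]"] bounds by auto
    then show ?thesis
      by (rule plateau_copy_across_cliques[OF H(1) _ A(1) B(1) disj _ _ _ cliques e(1) e_sub])
        (simp_all add: A(2) B(2) m(2) M(2) a_def b_def)
  next
    \<comment> \<open>A partition lists its parts in decreasing order, so now \<open>b\<close> comes first;
      it still lies between \<open>k\<close> and \<open>r - 1\<close>.\<close>
    case False
    then have "partition_of r [b, a]" using ab bounds by (simp add: partition_of_def)
    moreover have "k \<le> b" "b \<le> r - 1" using ab bounds False by linarith+
    ultimately obtain e\<^sub>0 where "plateau r H [b, a] e\<^sub>0" using plateaus[of "[b, a]"] by auto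
    moreover have "B \<inter> A = {}" "e \<subseteq> B \<union> A" using disj e_sub by blast+
    moreover have "e' \<in> edges M" if "card e' = r" "e' \<subseteq> B \<or> e' \<subseteq> A" for e'
      using cliques that by blast
    ultimately show ?thesis
      using plateau_copy_across_cliques[OF H(1) _ B(1) A(1) _ _ _ _ _ e(1)]
      by (metis A(2) B(2) m(2) M(2) a_def b_def order_refl Un_commute)
  qed
  then show False using M_free by contradiction
qed

end
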